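(* For every type $t$, if $\llbracket t\rrbracket\neq\emptyset$, then $t\uparrow_\bot$ holds.
   Context: **Types.** Fix sets of class names $c$ and field names $f$. Types are the finite or infinite terms coinductively defined by $t ::= \mathit{int} \mid \mathit{obj}(c,[f_1{:}t_1,\ldots,f_n{:}t_n]) \mid t_1\vee t_2$. In an object type the fields are finitely many ($n\ge 0$) and distinct, and their order is immaterial. **Values.** Values are the finite or infinite terms coinductively defined by $v ::= i \mid \mathit{obj}(c,[f_1\mapsto v_1,\ldots,f_n\mapsto v_n])$ with $i\in\mathbb{Z}$; fields are again finitely many, distinct, and their order is immaterial. **Derivations.** A derivation is a (possibly infinite) tree whose nodes are pairs (judgment, rule label), such that each node together with its children is a valid instance of the labelled rule. A sub-derivation is a subtree rooted at some node. **Membership.** Judgments $v\in t$, with rules (interpreted coinductively): - (int): $i\in\mathit{int}$ for $i\in\mathbb{Z}$ (no premises). - ($\vee$L): from $v\in t_1$ infer $v\in t_1\vee t_2$. - ($\vee$R): from $v\in t_2$ infer $v\in t_1\vee t_2$. - (obj): from $v_1\in t_1,\ldots,v_n\in t_n$ infer $\mathit{obj}(c,[f_1\mapsto v_1,\ldots,f_n\mapsto v_n,\ldots])\in\mathit{obj}(c,[f_1{:}t_1,\ldots,f_n{:}t_n])$, where the final ellipsis in the value stands for zero or more additional fields. A membership derivation is contractive iff it contains no sub-derivation built only with membership rules ($\vee$L) and ($\vee$R). The relation $v\in t$ holds iff there is a contractive (possibly infinite) derivation for it. The interpretation of a type is $\llbracket t\rrbracket=\{v\mid v\in t\text{ holds}\}$.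 **The predicate $t\uparrow_\bot$.** It is defined by the following rules (interpreted coinductively): - ($\uparrow$int): $\mathit{int}\uparrow_\bot$ (no premises). - ($\uparrow\vee$L): from $t_1\uparrow_\bot$ infer $(t_1\vee t_2)\uparrow_\bot$. - ($\uparrow\vee$R): from $t_2\uparrow_\bot$ infer $(t_1\vee t_2)\uparrow_\bot$. - ($\uparrow$obj): from $t_1\uparrow_\bot,\ldots,t_n\uparrow_\bot$ infer $\mathit{obj}(c,[f_1{:}t_1,\ldots,f_n{:}t_n])\uparrow_\bot$. $t\uparrow_\bot$ holds iff there is a (possibly infinite) derivation for it that is contractive, i.e. contains no sub-derivation obtained by applying only rules ($\uparrow\vee$L) and ($\uparrow\vee$R). *)

theory Defs
  imports "HOL-Library.Finite_Map"
begin

text \<open>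
  The type variables \<open>'c\<close> and \<open>'f\<close> are the class names and the field names. Finite maps
  render field lists that are finite, have distinct field names, and are taken up to order.
\<close>

codatatype ('c, 'f) ty =
    TInt
  | TObj 'c "('f, ('c, 'f) ty) fmap"
  | TOr "('c, 'f) ty" "('c, 'f) ty"

codatatype ('c, 'f) val =
    VInt int
  | VObj 'c "('f, ('c, 'f) val) fmap"

codatatype ('j, 'r) deriv =
  Deriv (concl: 'j) (label: 'r) (prems: "('j, 'r) deriv list")

inductive subderiv :: "('j, 'r) deriv \<Rightarrow> ('j, 'r) deriv \<Rightarrow> bool" where
  subderiv_refl: "subderiv d d"
| subderiv_step: "subderiv d e \<Longrightarrow> e \<in> set (prems d') \<Longrightarrow> subderiv d d'"

text \<open>
  An inference system is a predicate \<open>R r js j\<close>: the premises \<open>js\<close> and the conclusion \<open>j\<close>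
  form an instance of the rule labelled \<open>r\<close>. The rules are interpreted coinductively because
  derivation trees may be infinite.
\<close>

definition derivation :: "('r \<Rightarrow> 'j list \<Rightarrow> 'j \<Rightarrow> bool) \<Rightarrow> ('j, 'r) deriv \<Rightarrow> bool" where
  "derivation R d \<longleftrightarrow>
     (\<forall>e. subderiv e d \<longrightarrow> R (label e) (map concl (prems e)) (concl e))"

definition built_only_with :: "'r set \<Rightarrow> ('j, 'r) deriv \<Rightarrow> bool" where
  "built_only_with L d \<longleftrightarrow> (\<forall>e. subderiv e d \<longrightarrow> label e \<in> L)"

definition contractive :: "'r set \<Rightarrow> ('j, 'r) deriv \<Rightarrow> bool" where
  "contractive L d \<longleftrightarrow> \<not> (\<exists>e. subderiv e d \<and> built_only_with L e)"

datatype mem_label = MInt | MOrL | MOrR | MObj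

text \<open>
  In the object rule, \<open>fs\<close> enumerates the fields of the object type in an arbitrary order; the
  object value may have further fields.
\<close>

inductive mem_rule ::
  "mem_label \<Rightarrow> (('c, 'f) val \<times> ('c, 'f) ty) list \<Rightarrow> ('c, 'f) val \<times> ('c, 'f) ty \<Rightarrow> bool" where
  mem_int: "mem_rule MInt [] (VInt i, TInt)"
| mem_orL: "mem_rule MOrL [(v, t1)] (v, TOr t1 t2)"
| mem_orR: "mem_rule MOrR [(v, t2)] (v, TOr t1 t2)"
| mem_obj: "distinct fs \<Longrightarrow> set fs = fset (fmdom ts) \<Longrightarrow> set fs \<subseteq> fset (fmdom vs) \<Longrightarrow>
    mem_rule MObj (map (\<lambda>f. (the (fmlookup vs f), the (fmlookup ts f))) fs)
      (VObj c vs, TObj c ts)"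

definition mem :: "('c, 'f) val \<Rightarrow> ('c, 'f) ty \<Rightarrow> bool" where
  "mem v t \<longleftrightarrow>
     (\<exists>d. derivation mem_rule d \<and> contractive {MOrL, MOrR} d \<and> concl d = (v, t))"

definition interp :: "('c, 'f) ty \<Rightarrow> ('c, 'f) val set" where
  "interp t = {v. mem v t}"

datatype up_label = UInt | UOrL | UOrR | UObj

inductive up_rule :: "up_label \<Rightarrow> ('c, 'f) ty list \<Rightarrow> ('c, 'f) ty \<Rightarrow> bool" where
  up_int: "up_rule UInt [] TInt"
| up_orL: "up_rule UOrL [t1] (TOr t1 t2)"
| up_orR: "up_rule UOrR [t2] (TOr t1 t2)"
| up_obj: "distinct fs \<Longrightarrow> set fs = fset (fmdom ts) \<Longrightarrow>
    up_rule UObj (map (\<lambda>f. the (fmlookup ts f)) fs) (TObj c ts)"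

definition up_bot :: "('c, 'f) ty \<Rightarrow> bool" where
  "up_bot t \<longleftrightarrow>
     (\<exists>d. derivation up_rule d \<and> contractive {UOrL, UOrR} d \<and> concl d = t)"

end

(* Forgetting the values turns a membership derivation for v in t into a derivation of the same shape
   for the predicate on t. Relabelling along the rule correspondence reflects the union labels, so
   contractivity is kept. *)
theory Submission
  imports Defs
begin

lemma subderiv_map_deriv:
  assumes "subderiv e d"
  shows "subderiv (map_deriv f g e) (map_deriv f g d)"
  using assms
proof induction
  case (subderiv_step d e d')
  have "map_deriv f g e \<in> set (prems (map_deriv f g d'))"
    using subderiv_step.hyps by (simp add: deriv.map_sel)
  with subderiv_step.IH show ?case
    by (rule subderiv.subderiv_step)
qed (rule subderiv_refl)

text \<open>The premises of a mapped node are the images of the premises of the original node, so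
  any path down the mapped tree can be followed in \<open>d\<close>. Injectivity of \<open>f\<close>
  or \<open>g\<close> plays no part: the preimage is found by position.\<close>

lemma subderiv_map_derivE:
  assumes "subderiv e (map_deriv f g d)"
  obtains e' where "subderiv e' d" "e = map_deriv f g e'"
proof -
  have "\<exists>e'. subderiv e' d \<and> e = map_deriv f g e'"
    using assms
  \<comment> \<open>Each step passes from the root to one of its premises, so the hypothesis must
    apply to the preimage of that premise instead of \<open>d\<close>.\<close>
  proof (induction e "map_deriv f g d" arbitrary: d)
    case (subderiv_step x y)
    then obtain y' where y': "y' \<in> set (prems d)" "y = map_deriv f g y'"
      by (auto simp: deriv.map_sel)
    from subderiv_step.hyps(2)[OF y'(2)] obtain x'
      where x': "subderiv x' y'" "x = map_deriv f g x'"
      by blast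
    from subderiv.subderiv_step[OF x'(1) y'(1)] x'(2) show ?case
      by blast
  next
    case subderiv_refl
    show ?case
      by (intro exI[of _ d] conjI subderiv.subderiv_refl refl)
  qed
  then show ?thesis using that by blast
qed

text \<open>Validity is a local condition at every node, so even for infinite trees a rule-by-rule
  translation suffices, without coinduction.\<close>

lemma derivation_map_deriv:
  assumes "derivation R d"
    and "\<And>r js j. R r js j \<Longrightarrow> S (g r) (map f js) (f j)"
  shows "derivation S (map_deriv f g d)"
  unfolding derivation_def
proof (intro allI impI)
  fix e assume "subderiv e (map_deriv f g d)"
  then obtain e' where e': "subderiv e' d" "e = map_deriv f g e'"
    by (rule subderiv_map_derivE)
  have "R (label e') (map concl (prems e')) (concl e')"
    using assms(1) e'(1) unfolding derivation_def by blast
  from assms(2)[OF this] show "S (label e) (map concl (prems e)) (concl e)"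
    by (simp add: e'(2) deriv.map_sel comp_def)
qed

text \<open>A subtree of the image labelled only in \<open>L\<close> pulls back to a subtree of
  \<open>d\<close> whose labels all lie in the preimage of \<open>L\<close>.\<close>

lemma contractive_map_deriv:
  assumes "contractive (g -` L) d"
  shows "contractive L (map_deriv f g d)"
  unfolding contractive_def
proof (intro notI, elim exE conjE)
  fix e assume "subderiv e (map_deriv f g d)" and only: "built_only_with L e"
  then obtain e' where e': "subderiv e' d" "e = map_deriv f g e'"
    by (blast elim: subderiv_map_derivE)
  have "built_only_with (g -` L) e'"
    unfolding built_only_with_def
  proof (intro allI impI)
    fix x assume "subderiv x e'"
    then have "label (map_deriv f g x) \<in> L"
      using only e'(2) subderiv_map_deriv unfolding built_only_with_def by blast
    then show "label x \<in> g -` L"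
      by (simp add: deriv.map_sel)
  qed
  with assms e'(1) show False
    unfolding contractive_def by blast
qed

primrec up_label_of :: "mem_label \<Rightarrow> up_label" where
  "up_label_of MInt = UInt"
| "up_label_of MOrL = UOrL"
| "up_label_of MOrR = UOrR"
| "up_label_of MObj = UObj"

lemma up_rule_of_mem_rule:
  assumes "mem_rule r js j"
  shows "up_rule (up_label_of r) (map snd js) (snd j)"
  using assms
proof cases
  \<comment> \<open>Since \<open>fs\<close> enumerates exactly the fields of the type, it also
    serves for \<open>up_obj\<close>; additional fields of the value contribute no premises.\<close>
  case (mem_obj fs ts vs c)
  then show ?thesis
    using up_obj[of fs ts c] by (simp add: comp_def)
qed (simp_all add: up_rule.intros)

lemma vimage_up_label_of_or: "up_label_of -` {UOrL, UOrR} = {MOrL, MOrR}"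
proof -
  have "up_label_of r \<in> {UOrL, UOrR} \<longleftrightarrow> r \<in> {MOrL, MOrR}" for r
    by (cases r) simp_all
  then show ?thesis by blast
qed

theorem theorem5p2:
  fixes t :: "('c, 'f) ty"
  assumes "interp t \<noteq> {}"
  shows "up_bot t"
proof -
  from assms obtain v :: "('c, 'f) val" and d
    where d: "derivation mem_rule d" "contractive {MOrL, MOrR} d" "concl d = (v, t)"
    unfolding interp_def mem_def by blast
  let ?d = "map_deriv snd up_label_of d"
  have "derivation up_rule ?d"
    using d(1) up_rule_of_mem_rule by (rule derivation_map_deriv)
  moreover have "contractive {UOrL, UOrR} ?d"
    using d(2) by (intro contractive_map_deriv) (simp only: vimage_up_label_of_or)
  moreover have "concl ?d = t"
    using d(3) by (simp add: deriv.map_sel)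
  ultimately show ?thesis
    unfolding up_bot_def by blast
qed

end
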